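(* Let $n\ge1$ be an integer and, for $f\in C(\triangle_H)$, define $$\mathcal L_n^*f(\mathbf t)=\sum_{\mathbf j\in\Lambda_n}f(\tfrac{\mathbf j}{4n})\,\ell^\triangle_{\mathbf j,n}(\mathbf t),\qquad \ell^\triangle_{\mathbf j,n}(\mathbf t)=\frac{\lambda^{(n)}_{\mathbf j}}{4n^3}\sum_{\mathbf k\in\Lambda_n}\lambda^{(n)}_{\mathbf k}\mathsf{TC}_{\mathbf k}(\mathbf t)\overline{\mathsf{TC}_{\mathbf k}(\tfrac{\mathbf j}{4n})}.$$ Then $\mathcal L_n^*f$ is the unique function in $\mathcal{TC}_n$ satisfying $\mathcal L_n^*f(\tfrac{\mathbf j}{4n})=f(\tfrac{\mathbf j}{4n})$ for all $\mathbf j\in\Lambda_n$. Furthermore, $$\ell^\triangle_{\mathbf j,n}(\mathbf t)=\lambda^{(n)}_{\mathbf j}\,\mathcal P^+\ell_{\mathbf j,n}(\mathbf t),\qquad\text{where } \ell_{\mathbf j,n}(\mathbf t)=\Phi_n^*(\mathbf t-\tfrac{\mathbf j}{4n}).$$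
   Context: Let $\mathbb R^4_H=\{\mathbf t\in\mathbb R^4: t_1+t_2+t_3+t_4=0\}$, $\mathbb Z^4_H=\mathbb Z^4\cap\mathbb R^4_H$, $\mathbb H=\{\mathbf k\in\mathbb Z^4_H: k_1\equiv k_2\equiv k_3\equiv k_4\pmod4\}$, $\phi_{\mathbf k}(\mathbf t)=e^{\frac{\pi i}{2}\mathbf k\cdot\mathbf t}$. Let $\mathcal G=S_4$ act on $\mathbf t$ by permuting coordinates, $\mathbf t\mapsto\mathbf t\sigma$; $\mathcal P^+f(\mathbf t)=\frac1{24}\sum_{\sigma\in\mathcal G}f(\mathbf t\sigma)$ and $\mathsf{TC}_{\mathbf k}=\mathcal P^+\phi_{\mathbf k}$. Let $\triangle_H=\{\mathbf t\in\mathbb R^4_H: t_1-t_2,\,t_2-t_3,\,t_3-t_4,\,t_1-t_4\in[0,1]\}$, $\Lambda_n=\{\mathbf k\in\mathbb H: k_4\le k_3\le k_2\le k_1\le k_4+4n\}$, $\mathcal{TC}_n=\operatorname{span}\{\mathsf{TC}_{\mathbf k}:\mathbf k\in\Lambda_n\}$. For $\mathbf j\in\Lambda_n$ consider the relations (a) $j_1=j_2$, (b) $j_2=j_3$, (c) $j_3=j_4$, (d) $j_1=j_4+4n$; $\lambda^{(n)}_{\mathbf j}=24$ if none holds, $12$ if exactly one holds, $6$ if exactly two hold and they are $\{(a),(c)\}$ or $\{(b),(d)\}$, $4$ if exactly two other ones hold, and $1$ if three hold. Let $\mathbb H_n^*=\{\mathbf k\in\mathbb H: -4n\le k_i-k_j\le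 4n,\ i<j\}$; for $\mathbf k\in\mathbb H_n^*$, $c^{(n)}_{\mathbf k}=1$ if $\max_ik_i-\min_ik_i<4n$ and otherwise $c^{(n)}_{\mathbf k}=1/\binom{p+q}{p}$ with $p$ (resp. $q$) the number of coordinates equal to $\max_ik_i$ (resp. $\min_ik_i$). Finally $\Phi_n^*(\mathbf t)=\frac1{4n^3}\sum_{\mathbf k\in\mathbb H_n^*}c^{(n)}_{\mathbf k}\phi_{\mathbf k}(\mathbf t)$. *)

theory Defs
  imports "HOL-Analysis.Analysis" "HOL-Combinatorics.Permutations"
begin

text \<open>Points of R^4 are real^4, lattice points int^4; coordinates 1,2,3,4
  (in the numeral type 4 the index 4 is the same element as 0, distinct from 1,2,3).\<close>

definition RH :: "(real^4) set" where
  "RH = {t. (\<Sum>i\<in>UNIV. t $ i) = 0}"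

definition HH :: "(int^4) set" where
  "HH = {k. (\<Sum>i\<in>UNIV. k $ i) = 0 \<and> (\<forall>i j. k $ i mod 4 = k $ j mod 4)}"

definition phi :: "int^4 \<Rightarrow> real^4 \<Rightarrow> complex" where
  "phi k t = exp (\<i> * of_real (pi / 2 * (\<Sum>i\<in>UNIV. of_int (k $ i) * t $ i)))"

definition permact :: "real^4 \<Rightarrow> (4 \<Rightarrow> 4) \<Rightarrow> real^4" where
  "permact t \<sigma> = (\<chi> i. t $ \<sigma> i)"

definition Pplus :: "(real^4 \<Rightarrow> complex) \<Rightarrow> real^4 \<Rightarrow> complex" where
  "Pplus f t = (1/24) * (\<Sum>\<sigma>\<in>{\<sigma>. \<sigma> permutes (UNIV :: 4 set)}. f (permact t \<sigma>))"

definition TC :: "int^4 \<Rightarrow> real^4 \<Rightarrow> complex" where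
  "TC k = Pplus (phi k)"

definition triangleH :: "(real^4) set" where
  "triangleH = {t \<in> RH. t$1 - t$2 \<in> {0..1} \<and> t$2 - t$3 \<in> {0..1} \<and>
                        t$3 - t$4 \<in> {0..1} \<and> t$1 - t$4 \<in> {0..1}}"

definition Lambda :: "nat \<Rightarrow> (int^4) set" where
  "Lambda n = {k \<in> HH. k$4 \<le> k$3 \<and> k$3 \<le> k$2 \<and> k$2 \<le> k$1 \<and> k$1 \<le> k$4 + 4 * int n}"

definition TCspace :: "nat \<Rightarrow> (real^4 \<Rightarrow> complex) set" where
  "TCspace n = {g. \<exists>c :: int^4 \<Rightarrow> complex. g = (\<lambda>t. \<Sum>k\<in>Lambda n. c k * TC k t)}"

definition lam :: "nat \<Rightarrow> int^4 \<Rightarrow> real" where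
  "lam n j = (let ra = (j$1 = j$2); rb = (j$2 = j$3); rc = (j$3 = j$4);
                  rd = (j$1 = j$4 + 4 * int n);
                  cnt = of_bool ra + of_bool rb + of_bool rc + (of_bool rd :: nat)
              in if cnt = 0 then 24
                 else if cnt = 1 then 12
                 else if cnt = 2 \<and> ((ra \<and> rc) \<or> (rb \<and> rd)) then 6
                 else if cnt = 2 then 4
                 else if cnt = 3 then 1
                 else 0)"

definition Hstar :: "nat \<Rightarrow> (int^4) set" where
  "Hstar n = {k \<in> HH. \<forall>i j. - 4 * int n \<le> k$i - k$j \<and> k$i - k$j \<le> 4 * int n}"

definition cst :: "nat \<Rightarrow> int^4 \<Rightarrow> real" where
  "cst n k = (let M = Max (range (\<lambda>i. k$i)); m = Min (range (\<lambda>i. k$i));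
                  p = card {i. k$i = M}; q = card {i. k$i = m}
              in if M - m < 4 * int n then 1 else 1 / real ((p + q) choose p))"

definition Phistar :: "nat \<Rightarrow> real^4 \<Rightarrow> complex" where
  "Phistar n t = (1 / (4 * of_nat n ^ 3)) * (\<Sum>k\<in>Hstar n. of_real (cst n k) * phi k t)"

definition node :: "nat \<Rightarrow> int^4 \<Rightarrow> real^4" where
  "node n j = (\<chi> i. of_int (j$i) / (4 * real n))"

definition ell_tri :: "nat \<Rightarrow> int^4 \<Rightarrow> real^4 \<Rightarrow> complex" where
  "ell_tri n j t = of_real (lam n j) / (4 * of_nat n ^ 3) *
     (\<Sum>k\<in>Lambda n. of_real (lam n k) * TC k t * cnj (TC k (node n j)))"

definition Lstar :: "nat \<Rightarrow> (real^4 \<Rightarrow> complex) \<Rightarrow> real^4 \<Rightarrow> complex" where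
  "Lstar n f t = (\<Sum>j\<in>Lambda n. f (node n j) * ell_tri n j t)"

definition ell :: "nat \<Rightarrow> int^4 \<Rightarrow> real^4 \<Rightarrow> complex" where
  "ell n j t = Phistar n (t - node n j)"

end

(* On the nodes, phi k (node n j) is a symmetric, nondegenerate pairing on the finite group
   HH / 4n A_3, which has 4 n^3 elements, so its characters are orthogonal. Lambda n is the closed
   alcove of the affine Weyl group and meets each S_4-orbit of this group exactly once, in an orbit of
   length lam n j. Averaging over S_4 therefore turns the orthogonality of characters into
   orthogonality of the TC k on the nodes with weights lam; since TC k (node n j) is symmetric in
   k and j, this gives both the interpolation property and the uniqueness. Hstar n is the scaled Voronoi
   cell of the lattice A_3, on which cst distributes the mass 1 over each congruence class, and folding the
   sum over Hstar n onto the alcove yields the formula with Pplus. *)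

theory Submission
  imports Defs "HOL-Number_Theory.Cong"
begin

section \<open>Permutations of four indices and the weights\<close>

text \<open>The weights \<open>lam\<close> and \<open>cst\<close> come as tables of cases, while
  folding a sum produces orbit lengths. Both are therefore first expressed through stabilizers in
  S_4: permutations fixing \<open>k\<close> modulo \<open>4n\<close> for \<open>lam\<close>,
  permutations fixing \<open>k\<close> exactly for \<open>lam\<close> divided by \<open>cst\<close>.
  Two foldings are needed, of the finite group and of \<open>Hstar n\<close>, and they differ only
  in what counts as the same point: congruence modulo \<open>4n\<close> or equality. Hence
  \<open>cong4\<close> carries its modulus as a parameter and one double counting lemma serves both.
  The S_4-symmetric cell \<open>Hstar n\<close> is not a product, so character sums are evaluated on
  a box of representatives instead; that box is not S_4-invariant, which is why permutations enter
  the double counting as a relation and not as an action on the summation set. Uniqueness needs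
  neither a dimension count nor linear independence of the \<open>TC k\<close>: the interpolation
  operator reproduces each \<open>TC k\<close>, hence everything in their span.\<close>

lemma sum_permutes_4:
  fixes f :: "(4 \<Rightarrow> 4) \<Rightarrow> 'a::comm_monoid_add"
  shows "(\<Sum>\<sigma> | \<sigma> permutes (UNIV::4 set). f \<sigma>) =
    (\<Sum>a\<in>{1,2,3,4}. \<Sum>b\<in>{2,3,4}. \<Sum>c\<in>{3,4}. 
      f (Transposition.transpose 1 a \<circ> (Transposition.transpose 2 b \<circ> Transposition.transpose 3 c)))"
proof -
  have A: "finite {2::4,3,4}" "1 \<notin> {2::4,3,4}" "finite {3::4,4}" "2 \<notin> {3::4,4}" "finite {4::4}" "3 \<notin> {4::4}"
    by auto
  show ?thesis
    unfolding UNIV_4 sum_over_permutations_insert[OF A(1,2)] sum_over_permutations_insert[OF A(3,4)]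
      sum_over_permutations_insert[OF A(5,6)] permutes_sing
    by simp
qed

text \<open>One-line notation, in the order in which the expansion into transpositions produces the
  permutations, so that the two sums agree term by term without reordering.\<close>

definition perms4 :: "(4 \<times> 4 \<times> 4 \<times> 4) list" where
  "perms4 = [
    (1,2,3,4), (1,2,4,3), (1,3,2,4), (1,3,4,2), (1,4,3,2), (1,4,2,3),
    (2,1,3,4), (2,1,4,3), (2,3,1,4), (2,3,4,1), (2,4,3,1), (2,4,1,3),
    (3,2,1,4), (3,2,4,1), (3,1,2,4), (3,1,4,2), (3,4,1,2), (3,4,2,1),
    (4,2,3,1), (4,2,1,3), (4,3,2,1), (4,3,1,2), (4,1,3,2), (4,1,2,3)]"

lemma sum_permutes_4_list:
  fixes F :: "4 \<Rightarrow> 4 \<Rightarrow> 4 \<Rightarrow> 4 \<Rightarrow> 'a::comm_monoid_add"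
  shows "(\<Sum>\<sigma> | \<sigma> permutes (UNIV::4 set). F (\<sigma> 1) (\<sigma> 2) (\<sigma> 3) (\<sigma> 4)) =
    (\<Sum>(p, q, r, s)\<leftarrow>perms4. F p q r s)"
proof -
  have ne: "(1::4) \<noteq> 2" "(1::4) \<noteq> 3" "(1::4) \<noteq> 4" "(2::4) \<noteq> 3" "(2::4) \<noteq> 4" "(3::4) \<noteq> 4"
    "(2::4) \<noteq> 1" "(3::4) \<noteq> 1" "(4::4) \<noteq> 1" "(3::4) \<noteq> 2" "(4::4) \<noteq> 2" "(4::4) \<noteq> 3"
    by simp_all
  show ?thesis
    unfolding sum_permutes_4 perms4_def o_def
    by (simp only: sum.insert finite.intros insert_iff empty_iff sum.empty ne simp_thms
        Transposition.transpose_def if_True if_False if_cancel list.map sum_list.Cons sum_list.Nil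
        split_conv add.assoc add_0_right add_0_left refl)
qed

lemma card_permutes_4:
  "card {\<sigma>. \<sigma> permutes (UNIV::4 set) \<and> (\<forall>i. R (\<sigma> i) i)} =
    length (filter (\<lambda>(p, q, r, s). R p 1 \<and> R q 2 \<and> R r 3 \<and> R s 4) perms4)"
proof -
  have "card {\<sigma>. \<sigma> permutes (UNIV::4 set) \<and> (\<forall>i. R (\<sigma> i) i)} =
     (\<Sum>\<sigma> | \<sigma> permutes (UNIV::4 set). of_bool (R (\<sigma> 1) 1 \<and> R (\<sigma> 2) 2 \<and> R (\<sigma> 3) 3 \<and> R (\<sigma> 4) 4))"
    unfolding forall_4 by (simp add: Collect_conj_eq[symmetric] finite_permutations Int_def)
  also have "\<dots> = (\<Sum>(p, q, r, s)\<leftarrow>perms4. of_bool (R p 1 \<and> R q 2 \<and> R r 3 \<and> R s 4))"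
    by (rule sum_permutes_4_list)
  \<comment> \<open>The list is replaced by a variable so that induction applies.\<close>
  also have "\<dots> = length (filter (\<lambda>(p, q, r, s). R p 1 \<and> R q 2 \<and> R r 3 \<and> R s 4) xs)" if "xs = perms4" for xs
    unfolding that[symmetric] by (induction xs) auto
  finally show ?thesis by simp
qed

text \<open>Orbit-stabilizer. The relations (a), (b), (c), (d) form a 4-cycle on the indices. Two
  opposite ones give two congruent pairs and stabilizer order 4, two adjacent ones a congruent
  triple and order 6, three make all entries congruent and give order 24. This explains the values
  6, 4 and 1.\<close>

lemma lam_card_stabilizer_mod:
  assumes n: "n \<ge> 1" and k: "k \<in> Lambda n"
  shows "lam n k * card {\<sigma>. \<sigma> permutes UNIV \<and> (\<forall>i. [k $ \<sigma> i = k $ i] (mod (4 * int n)))} = 24"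
proof -
  define N where "N = 4 * int n"
  have N: "N > 0" using n by (simp add: N_def)
  have o: "k$4 \<le> k$3" "k$3 \<le> k$2" "k$2 \<le> k$1" "k$1 \<le> k$4 + N"
    using k by (auto simp: Lambda_def N_def)
  define R where "R = (\<lambda>i j. [k $ i = k $ j] (mod N))"
  have c: "R i j \<longleftrightarrow> k$i = k$j \<or> k$i = k$j + N" if "k$i \<le> k$j + N" "k$j \<le> k$i" for i j
  proof -
    have "[k$i - k$j = 0] (mod N) \<longleftrightarrow> k$i - k$j = 0 \<or> k$i - k$j = N"
      using that N by (cases "k$i - k$j = N") (auto simp: cong_def)
    then show ?thesis unfolding R_def cong_diff_iff_cong_0 by auto
  qed
  have refl: "R i i" and sym: "R i j \<longleftrightarrow> R j i" for i j
    by (auto simp: R_def cong_sym_eq)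
  define ra rb rc rd where "ra \<longleftrightarrow> k$1 = k$2" and "rb \<longleftrightarrow> k$2 = k$3" and "rc \<longleftrightarrow> k$3 = k$4"
    and "rd \<longleftrightarrow> k$1 = k$4 + N"
  note r = ra_def rb_def rc_def rd_def
  \<comment> \<open>The gaps \<open>k$1 - k$2\<close>, \<open>k$2 - k$3\<close>,
    \<open>k$3 - k$4\<close>, \<open>k$4 + N - k$1\<close> are nonnegative and sum to
    \<open>N\<close>. Two entries are congruent exactly if all gaps vanish on one of the two arcs of
    the cycle between their indices.\<close>
  have r12: "R 1 2 \<longleftrightarrow> ra \<or> rb \<and> rc \<and> rd" using c[of 1 2] o unfolding r by auto
  have r23: "R 2 3 \<longleftrightarrow> rb \<or> ra \<and> rc \<and> rd" using c[of 2 3] o unfolding r by auto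
  have r34: "R 3 4 \<longleftrightarrow> rc \<or> ra \<and> rb \<and> rd" using c[of 3 4] o unfolding r by auto
  have r14: "R 1 4 \<longleftrightarrow> rd \<or> ra \<and> rb \<and> rc" using c[of 1 4] o unfolding r by auto
  have r13: "R 1 3 \<longleftrightarrow> ra \<and> rb \<or> rc \<and> rd" using c[of 1 3] o unfolding r by auto
  have r24: "R 2 4 \<longleftrightarrow> rb \<and> rc \<or> ra \<and> rd" using c[of 2 4] o unfolding r by auto
  have "\<not> (ra \<and> rb \<and> rc \<and> rd)" using N unfolding r by auto
  moreover have "card {\<sigma>. \<sigma> permutes UNIV \<and> (\<forall>i. [k $ \<sigma> i = k $ i] (mod N))} =
      card {\<sigma>. \<sigma> permutes UNIV \<and> (\<forall>i. R (\<sigma> i) i)}"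
    by (simp add: R_def)
  moreover have "\<dots> = length (filter (\<lambda>(p, q, r, s). R p 1 \<and> R q 2 \<and> R r 3 \<and> R s 4) perms4)"
    by (rule card_permutes_4)
  ultimately show ?thesis
    unfolding N_def[symmetric] lam_def Let_def r[symmetric]
    by (cases ra; cases rb; cases rc; cases rd)
      (simp_all add: perms4_def refl r12 r23 r34 r14 r13 r24
        sym[of 2 1] sym[of 3 1] sym[of 4 1] sym[of 3 2] sym[of 4 2] sym[of 4 3])
qed

text \<open>Compared with the stabilizer modulo \<open>4n\<close>, this says that \<open>cst\<close>
  is the quotient of the exact stabilizer by that one: if the spread is \<open>4n\<close>, the
  \<open>p\<close> maxima and \<open>q\<close> minima merge into one congruence class, and
  \<open>p! q!\<close> grows to \<open>(p+q)!\<close>.\<close>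

lemma lam_card_stabilizer:
  assumes n: "n \<ge> 1" and k: "k \<in> Lambda n"
  shows "lam n k * card {\<sigma>. \<sigma> permutes UNIV \<and> (\<forall>i. k $ \<sigma> i = k $ i)} = 24 * cst n k"
proof -
  define N where "N = 4 * int n"
  have N: "N > 0" using n by (simp add: N_def)
  have o: "k$4 \<le> k$3" "k$3 \<le> k$2" "k$2 \<le> k$1" "k$1 \<le> k$4 + N"
    using k by (auto simp: Lambda_def N_def)
  have M: "Max (range (\<lambda>i. k$i)) = k$1" "Min (range (\<lambda>i. k$i)) = k$4"
    using o unfolding UNIV_4 by simp_all
  have C: "card {i. k$i = x} = of_bool (k$1 = x) + of_bool (k$2 = x) + of_bool (k$3 = x) + of_bool (k$4 = x)" for x
  proof -
    have "card {i. k$i = x} = (\<Sum>i\<in>UNIV. of_bool (k$i = x))"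
      by simp
    then show ?thesis unfolding sum_4 .
  qed
  define ra rb rc rd where "ra \<longleftrightarrow> k$1 = k$2" and "rb \<longleftrightarrow> k$2 = k$3" and "rc \<longleftrightarrow> k$3 = k$4"
    and "rd \<longleftrightarrow> k$1 = k$4 + N"
  note r = ra_def rb_def rc_def rd_def
  have e: "k$2 = k$1 \<longleftrightarrow> ra" "k$3 = k$2 \<longleftrightarrow> rb" "k$4 = k$3 \<longleftrightarrow> rc"
    "k$1 = k$3 \<longleftrightarrow> ra \<and> rb" "k$3 = k$1 \<longleftrightarrow> ra \<and> rb" "k$2 = k$4 \<longleftrightarrow> rb \<and> rc" "k$4 = k$2 \<longleftrightarrow> rb \<and> rc"
    "k$1 = k$4 \<longleftrightarrow> ra \<and> rb \<and> rc" "k$4 = k$1 \<longleftrightarrow> ra \<and> rb \<and> rc" "k$1 - k$4 < N \<longleftrightarrow> \<not> rd"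
    using o unfolding r by auto
  have "\<not> (ra \<and> rb \<and> rc \<and> rd)" using N unfolding r by auto
  then show ?thesis
    unfolding card_permutes_4[of "\<lambda>i j. k $ i = k $ j"] lam_def cst_def Let_def M C N_def[symmetric] e r[symmetric]
    by (cases ra; cases rb; cases rc; cases rd) (simp_all add: perms4_def e numeral_eq_Suc flip: r)
qed

section \<open>The alcove as a transversal\<close>

definition sorted4 :: "int^4 \<Rightarrow> bool" where
  "sorted4 k \<longleftrightarrow> k$4 \<le> k$3 \<and> k$3 \<le> k$2 \<and> k$2 \<le> k$1"

text \<open>The hypothesis on \<open>g\<close> states equality of the multisets of entries;
  indicator functions recover the multiplicities. In this form it can be verified by adding up a
  pointwise identity.\<close>

lemma sorted4_unique:
  assumes "sorted4 k" "sorted4 l"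
    and g: "\<And>g :: int \<Rightarrow> int. (\<Sum>i\<in>UNIV. g (l $ i)) = (\<Sum>i\<in>UNIV. g (k $ i))"
  shows "l = k"
proof -
  let ?L = "\<lambda>k. [k$4, k$3, k$2, k$1 :: int]"
  have c: "int (count (mset (?L k)) x) = (\<Sum>i\<in>UNIV. of_bool (k$i = x))" for k :: "int^4" and x
    unfolding sum_4 by (simp del: sum_of_bool_eq)
  have "mset (?L l) = mset (?L k)"
  proof (rule multiset_eqI)
    fix x show "count (mset (?L l)) x = count (mset (?L k)) x"
      using c[of l x] c[of k x] g[of "\<lambda>y. of_bool (y = x)"] by linarith
  qed
  moreover have "sorted (?L l)" "sorted (?L k)" using assms by (auto simp: sorted4_def)
  ultimately have "?L l = ?L k"
    by (metis properties_for_sort)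
  then show ?thesis by (simp add: vec_eq_iff forall_4)
qed

text \<open>If \<open>l = k\<sigma> + N a\<close> with \<open>a \<noteq> 0\<close>, the bound \<open>N\<close> on the spread of both vectors forces every entry
  moved by \<open>a\<close> to jump between the common minimum and the common maximum, equally often in either
  direction, so the multiset of entries does not change.\<close>

lemma Lambda_unique:
  assumes n: "n \<ge> 1" and k: "k \<in> Lambda n" and l: "l \<in> Lambda n"
    and s: "\<sigma> permutes UNIV" and c: "\<And>i. [k $ \<sigma> i = l $ i] (mod (4 * int n))"
  shows "l = k"
proof (rule sorted4_unique)
  define N where "N = 4 * int n"
  have N: "N > 0" using n by (simp add: N_def)
  show "sorted4 k" "sorted4 l" using k l by (auto simp: Lambda_def sorted4_def)
  have bound: "m $ 4 \<le> m $ i \<and> m $ i \<le> m $ 1 \<and> m $ 1 \<le> m $ 4 + N" if "m \<in> Lambda n" for m i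
    using that exhaust_4[of i] by (auto simp: Lambda_def N_def)
  have "\<forall>i. \<exists>a. l $ i = k $ \<sigma> i + N * a"
    using c unfolding N_def[symmetric] by (metis cong_iff_lin)
  then obtain a where a: "\<And>i. l $ i = k $ \<sigma> i + N * a i" by metis
  have perm: "(\<Sum>i\<in>UNIV. g (k $ \<sigma> i)) = (\<Sum>i\<in>UNIV. g (k $ i))" for g :: "int \<Rightarrow> int"
    using sum.permute[OF s, of "\<lambda>i. g (k $ i)"] by (simp add: o_def)
  have "(\<Sum>i\<in>UNIV. l $ i) = (\<Sum>i\<in>UNIV. k $ \<sigma> i) + N * (\<Sum>i\<in>UNIV. a i)"
    by (simp add: a sum.distrib sum_distrib_left)
  then have a0: "(\<Sum>i\<in>UNIV. a i) = 0"
    using k l N perm[of "\<lambda>x. x"] by (auto simp: Lambda_def HH_def)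
  have extremal: "k$1 = k$4 + N \<and> k $ \<sigma> i = k$4 \<and> l $ i = k$1 \<and> a i = 1 \<and>
      k $ \<sigma> j = k$1 \<and> l $ j = k$4 \<and> a j = -1"
    if "a i > 0" "a j < 0" for i j
  proof -
    have B: "k$4 \<le> k $ \<sigma> i" "k $ \<sigma> j \<le> k$1" "k$1 \<le> k$4 + N" "l $ i - l $ j \<le> N"
      using bound[OF k, of "\<sigma> i"] bound[OF k, of "\<sigma> j"] bound[OF l, of i] bound[OF l, of j] by auto
    have "N * 1 \<le> N * a i" "N * a j \<le> N * -1"
      using that N by (simp_all only: mult_le_cancel_left_pos)
    then have "N * a i = N" "N * a j = - N" "k$1 = k$4 + N" "k $ \<sigma> i = k$4" "k $ \<sigma> j = k$1"
      using B a[of i] a[of j] by linarith+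
    moreover have "a i = 1" "a j = -1" using calculation(1,2) N mult_cancel_left[of N "a j" "-1"] by auto
    ultimately show ?thesis using a[of i] a[of j] by simp
  qed
  fix g :: "int \<Rightarrow> int"
  \<comment> \<open>Since \<open>a i\<close> is -1, 0 or 1, the effect of a jump is linear in
    \<open>a i\<close>, and it cancels in the sum over \<open>i\<close>.\<close>
  have "g (l $ i) = g (k $ \<sigma> i) + a i * (g (k$1) - g (k$4))" for i
  proof (cases "a i = 0")
    case True
    then show ?thesis by (simp add: a)
  next
    case False
    have "\<exists>j. a j < 0" if "a i > 0"
      using a0 sum_nonneg_eq_0_iff[of UNIV a] that by (force simp: not_less)
    moreover have "\<exists>j. a j > 0" if "a i < 0"
      using a0 sum_nonneg_eq_0_iff[of UNIV "\<lambda>j. - a j"] that by (force simp: not_less sum_negf)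
    ultimately consider "a i > 0" "\<exists>j. a j < 0" | "a i < 0" "\<exists>j. a j > 0"
      using False by (metis linorder_neqE)
    then show ?thesis
    proof cases
      case 1
      then show ?thesis using extremal[of i] by fastforce
    next
      case 2
      then show ?thesis using extremal[of _ i] by fastforce
    qed
  qed
  then have "(\<Sum>i\<in>UNIV. g (l $ i)) = (\<Sum>i\<in>UNIV. g (k $ \<sigma> i)) + (\<Sum>i\<in>UNIV. a i) * (g (k$1) - g (k$4))"
    by (simp add: sum.distrib sum_distrib_right)
  then show "(\<Sum>i\<in>UNIV. g (l $ i)) = (\<Sum>i\<in>UNIV. g (k $ i))" by (simp add: a0 perm)
qed

definition pvec :: "'a^4 \<Rightarrow> (4 \<Rightarrow> 4) \<Rightarrow> 'a^4" where
  "pvec k \<sigma> = (\<chi> i. k $ \<sigma> i)"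

lemma pvec_nth [simp]: "pvec k \<sigma> $ i = k $ \<sigma> i"
  by (simp add: pvec_def)

text \<open>The affine reflection in the wall \<open>k$1 = k$4 + N\<close>.\<close>

definition refl4 :: "int \<Rightarrow> int^4 \<Rightarrow> int^4" where
  "refl4 N k = (\<chi> i. if i = 1 then k$4 + N else if i = 4 then k$1 - N else k$i)"

text \<open>The element of \<open>X\<close> closest to the interior point \<open>(n/2) (3, 1, -1, -3)\<close> of the alcove lies on the
  right side of each wall, since otherwise reflecting it in that wall would bring it closer.\<close>

lemma exists_dominant:
  assumes n: "n \<ge> 1" and ne: "X \<noteq> {}"
    and swap: "\<And>k i j. k \<in> X \<Longrightarrow> pvec k (Transposition.transpose i j) \<in> X"
  shows "\<exists>k\<in>X. sorted4 k \<and> (refl4 (4 * int n) k \<in> X \<longrightarrow> k$1 \<le> k$4 + 4 * int n)"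
proof -
  \<comment> \<open>Four times the squared distance to the chosen point, which keeps it integral; so
    a minimum exists even on an infinite \<open>X\<close>.\<close>
  define Q where "Q k = (2 * k$1 - 3 * int n)^2 + (2 * k$2 - int n)^2 + (2 * k$3 + int n)^2 + (2 * k$4 + 3 * int n)^2"
    for k :: "int^4"
  obtain k where k: "k \<in> X" and "\<And>k'. k' \<in> X \<Longrightarrow> nat (Q k) \<le> nat (Q k')"
    using ex_has_least_nat[of "\<lambda>k. k \<in> X" _ "\<lambda>k. nat (Q k)"] ne by blast
  moreover have "Q k \<ge> 0" for k unfolding Q_def by simp
  ultimately have min: "Q k \<le> Q k'" if "k' \<in> X" for k'
    using that by (meson nat_le_eq_zle)
  \<comment> \<open>The chosen point has distance gap \<open>n\<close> from each of the four walls,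
    so a reflection changes \<open>Q\<close> by \<open>8n\<close> times the gap of \<open>k\<close>
    at that wall, with the same factor every time.\<close>
  have pos: "x \<le> y" if "0 \<le> 8 * int n * (y - x)" for x y
    using that n by (auto simp: zero_le_mult_iff)
  have "k$2 \<le> k$1"
    by (rule pos) (use min[OF swap[OF k, of 1 2]] in \<open>simp add: Q_def Transposition.transpose_def power2_eq_square algebra_simps\<close>)
  moreover have "k$3 \<le> k$2"
    by (rule pos) (use min[OF swap[OF k, of 2 3]] in \<open>simp add: Q_def Transposition.transpose_def power2_eq_square algebra_simps\<close>)
  moreover have "k$4 \<le> k$3"
    by (rule pos) (use min[OF swap[OF k, of 3 4]] in \<open>simp add: Q_def Transposition.transpose_def power2_eq_square algebra_simps\<close>)
  \<comment> \<open>Conditional, because plain S_4 orbits are in general not closed under this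
    reflection; for orbits in \<open>Hstar n\<close> the bound comes from \<open>Hstar n\<close>
    itself.\<close>
  moreover have "k$1 \<le> k$4 + 4 * int n" if "refl4 (4 * int n) k \<in> X"
    by (rule pos) (use min[OF that] in \<open>simp add: Q_def refl4_def power2_eq_square algebra_simps\<close>)
  ultimately show ?thesis using k by (auto simp: sorted4_def)
qed

text \<open>Double counting of the triples \<open>(a, l, \<sigma>)\<close> with \<open>R \<sigma> a l\<close>, where \<open>L\<close> is a transversal of the orbits
  in \<open>A\<close> and \<open>w l\<close> is the length of the orbit of \<open>l\<close>.\<close>

lemma sum_transversal:
  fixes R :: "'s \<Rightarrow> 'a \<Rightarrow> 'b \<Rightarrow> bool" and F :: "'a \<Rightarrow> complex" and w :: "'b \<Rightarrow> real"
  assumes fin: "finite P" "finite A" "finite L" and P: "P \<noteq> {}"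
    and ex: "\<And>a. a \<in> A \<Longrightarrow> \<exists>l\<in>L. \<exists>\<sigma>\<in>P. R \<sigma> a l"
    and uniq: "\<And>a l l' \<sigma> \<sigma>'. a \<in> A \<Longrightarrow> l \<in> L \<Longrightarrow> l' \<in> L \<Longrightarrow> \<sigma> \<in> P \<Longrightarrow> \<sigma>' \<in> P \<Longrightarrow> R \<sigma> a l \<Longrightarrow> R \<sigma>' a l' \<Longrightarrow> l = l'"
    and stab: "\<And>a l \<sigma>. a \<in> A \<Longrightarrow> l \<in> L \<Longrightarrow> \<sigma> \<in> P \<Longrightarrow> R \<sigma> a l \<Longrightarrow> w l * card {\<sigma>\<in>P. R \<sigma> a l} = card P"
    and one: "\<And>l \<sigma>. l \<in> L \<Longrightarrow> \<sigma> \<in> P \<Longrightarrow> \<exists>!a. a \<in> A \<and> R \<sigma> a l"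
    and inv: "\<And>a l \<sigma>. a \<in> A \<Longrightarrow> l \<in> L \<Longrightarrow> \<sigma> \<in> P \<Longrightarrow> R \<sigma> a l \<Longrightarrow> F a = G l"
  shows "(\<Sum>a\<in>A. F a) = (\<Sum>l\<in>L. of_real (w l) * G l)"
proof -
  have row: "of_nat (card P) * F a = (\<Sum>l\<in>L. \<Sum>\<sigma>\<in>P. of_bool (R \<sigma> a l) * (of_real (w l) * G l))" if a: "a \<in> A" for a
  proof -
    obtain l \<sigma> where l: "l \<in> L" "\<sigma> \<in> P" "R \<sigma> a l" using ex[OF a] by blast
    have "(\<Sum>l'\<in>L. \<Sum>\<sigma>\<in>P. of_bool (R \<sigma> a l') * (of_real (w l') * G l')) =
        (\<Sum>l'\<in>L. if l' = l then of_nat (card {\<sigma>\<in>P. R \<sigma> a l}) * (of_real (w l) * G l) else 0)"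
    proof (rule sum.cong)
      fix l' assume l': "l' \<in> L"
      show "(\<Sum>\<sigma>\<in>P. of_bool (R \<sigma> a l') * (of_real (w l') * G l')) =
        (if l' = l then of_nat (card {\<sigma>\<in>P. R \<sigma> a l}) * (of_real (w l) * G l) else 0)"
      proof (cases "l' = l")
        case True
        then show ?thesis using fin by (simp add: sum_distrib_right[symmetric] Int_def)
      next
        case False
        then have "\<not> R \<sigma>' a l'" if "\<sigma>' \<in> P" for \<sigma>'
          using uniq[OF a l(1) l' l(2) that l(3)] by blast
        then show ?thesis using False by (simp add: sum.neutral)
      qed
    qed simp
    also have "\<dots> = of_real (w l * card {\<sigma>\<in>P. R \<sigma> a l}) * G l"
      using l fin by simp
    also have "\<dots> = of_nat (card P) * F a"
      using stab[OF a l] inv[OF a l] by simp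
    finally show ?thesis by simp
  qed
  have col: "(\<Sum>a\<in>A. of_bool (R \<sigma> a l)) = (1 :: complex)" if l: "l \<in> L" "\<sigma> \<in> P" for l \<sigma>
  proof -
    obtain a where a: "a \<in> A" "R \<sigma> a l" "\<And>b. b \<in> A \<Longrightarrow> R \<sigma> b l \<Longrightarrow> b = a"
      using one[OF l] by blast
    then have "{a\<in>A. R \<sigma> a l} = {a}" by blast
    then show ?thesis using fin by (simp add: Int_def)
  qed
  have "of_nat (card P) * (\<Sum>a\<in>A. F a) =
      (\<Sum>a\<in>A. \<Sum>l\<in>L. \<Sum>\<sigma>\<in>P. of_bool (R \<sigma> a l) * (of_real (w l) * G l))"
    by (simp add: sum_distrib_left row)
  also have "\<dots> = (\<Sum>l\<in>L. \<Sum>\<sigma>\<in>P. (\<Sum>a\<in>A. of_bool (R \<sigma> a l)) * (of_real (w l) * G l))"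
    unfolding sum_distrib_right by (subst sum.swap, intro sum.cong refl, subst sum.swap, rule refl)
  also have "\<dots> = of_nat (card P) * (\<Sum>l\<in>L. of_real (w l) * G l)"
    by (simp add: col sum_distrib_left)
  finally show ?thesis using P fin by simp
qed

text \<open>The modulus 0 is meaningful: it turns the congruence into equality.\<close>

definition cong4 :: "int \<Rightarrow> (4 \<Rightarrow> 4) \<Rightarrow> int^4 \<Rightarrow> int^4 \<Rightarrow> bool" where
  "cong4 m \<sigma> k l \<longleftrightarrow> (\<forall>i. [k $ \<sigma> i = l $ i] (mod m))"

lemma cong4_comp:
  assumes "cong4 m \<sigma> k l"
  shows "cong4 m (\<sigma> \<circ> \<tau>) k h \<longleftrightarrow> cong4 m \<tau> l h"
proof -
  have "[k $ \<sigma> (\<tau> i) = h $ i] (mod m) \<longleftrightarrow> [l $ \<tau> i = h $ i] (mod m)" for i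
    using assms unfolding cong4_def cong_def by simp
  then show ?thesis by (simp add: cong4_def)
qed

text \<open>Left translation by \<open>\<sigma>\<close>. For \<open>h = l\<close> it turns the
  number of permutations carrying a point to its representative into the size of a
  stabilizer.\<close>

lemma card_cong4:
  assumes \<sigma>: "\<sigma> permutes UNIV" "cong4 m \<sigma> k l"
  shows "card {\<tau>. \<tau> permutes UNIV \<and> cong4 m \<tau> k h} = card {\<tau>. \<tau> permutes UNIV \<and> cong4 m \<tau> l h}"
proof -
  have "bij_betw ((\<circ>) \<sigma>) {\<tau>. \<tau> permutes UNIV \<and> cong4 m \<tau> l h} {\<tau>. \<tau> permutes UNIV \<and> cong4 m \<tau> k h}"
  proof (rule bij_betw_byWitness[where f' = "(\<circ>) (inv \<sigma>)"])
    show "\<forall>\<tau>\<in>{\<tau>. \<tau> permutes UNIV \<and> cong4 m \<tau> l h}. inv \<sigma> \<circ> (\<sigma> \<circ> \<tau>) = \<tau>"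
      "\<forall>\<tau>\<in>{\<tau>. \<tau> permutes UNIV \<and> cong4 m \<tau> k h}. \<sigma> \<circ> (inv \<sigma> \<circ> \<tau>) = \<tau>"
      using permutes_inv_o[OF \<sigma>(1)] by (simp_all add: o_assoc)
    show "(\<circ>) \<sigma> ` {\<tau>. \<tau> permutes UNIV \<and> cong4 m \<tau> l h} \<subseteq> {\<tau>. \<tau> permutes UNIV \<and> cong4 m \<tau> k h}"
      using cong4_comp[OF \<sigma>(2)] by (auto intro: permutes_compose \<sigma>)
    show "(\<circ>) (inv \<sigma>) ` {\<tau>. \<tau> permutes UNIV \<and> cong4 m \<tau> k h} \<subseteq> {\<tau>. \<tau> permutes UNIV \<and> cong4 m \<tau> l h}"
    proof clarify
      fix \<tau> :: "4 \<Rightarrow> 4" assume t: "\<tau> permutes UNIV" "cong4 m \<tau> k h"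
      have "\<sigma> \<circ> (inv \<sigma> \<circ> \<tau>) = \<tau>" using permutes_inv_o[OF \<sigma>(1)] by (simp add: o_assoc)
      then show "inv \<sigma> \<circ> \<tau> permutes UNIV \<and> cong4 m (inv \<sigma> \<circ> \<tau>) l h"
        using cong4_comp[OF \<sigma>(2), of "inv \<sigma> \<circ> \<tau>" h] t by (auto intro: permutes_compose permutes_inv \<sigma>)
    qed
  qed
  then show ?thesis by (rule bij_betw_same_card[symmetric])
qed

lemma cong4_swap:
  assumes "\<sigma> permutes UNIV"
  shows "cong4 m \<sigma> k l \<longleftrightarrow> cong4 m (inv \<sigma>) l k"
proof -
  have "cong4 m (inv \<sigma>) l k" if "\<sigma> permutes UNIV" "cong4 m \<sigma> k l" for \<sigma> k l
    unfolding cong4_def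
  proof
    fix i
    have "[k $ \<sigma> (inv \<sigma> i) = l $ inv \<sigma> i] (mod m)" using that unfolding cong4_def by blast
    then show "[l $ inv \<sigma> i = k $ i] (mod m)"
      using permutes_inverses(1)[OF that(1)] by (simp add: cong_sym_eq)
  qed
  from this[OF assms] this[OF permutes_inv[OF assms]] show ?thesis
    by (auto simp: permutes_inv_inv[OF assms])
qed

section \<open>Characters on the finite quotient\<close>

definition dot4 :: "int^4 \<Rightarrow> int^4 \<Rightarrow> int" where
  "dot4 k j = (\<Sum>i\<in>UNIV. k $ i * j $ i)"

text \<open>The value of \<open>phi k\<close> at the node of \<open>j\<close>, as a function of two
  lattice vectors; the denominator comes from \<open>pi/2 / (4n) = 2 pi / (16n)\<close>.\<close>

definition chr :: "nat \<Rightarrow> int^4 \<Rightarrow> int^4 \<Rightarrow> complex" where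
  "chr n k j = cis (2 * pi * of_int (dot4 k j) / (16 * real n))"

lemma phi_node: "phi k (node n j) = chr n k j"
proof -
  have "(\<Sum>i\<in>UNIV. of_int (k $ i) * node n j $ i) = of_int (dot4 k j) / (4 * real n)"
    by (simp add: node_def dot4_def sum_divide_distrib)
  then show ?thesis unfolding phi_def chr_def cis_conv_exp by (simp add: field_simps)
qed

lemma dot4_commute: "dot4 k j = dot4 j k"
  by (simp add: dot4_def mult.commute)

lemma dot4_pvec:
  assumes "\<sigma> permutes UNIV"
  shows "dot4 k (pvec j \<sigma>) = dot4 (pvec k (inv \<sigma>)) j"
  using sum.permute[OF permutes_inv[OF assms], of "\<lambda>i. k $ i * j $ \<sigma> i"]
  by (simp add: dot4_def o_def permutes_inverses[OF assms])

lemma cis_eq_1_imp: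
  assumes "cis (2 * pi * x) = 1"
  shows "x \<in> \<int>"
proof -
  have "cos (2 * pi * x) = 1" using assms by (metis cis.sel(1) one_complex.sel(1))
  then obtain m :: int where "2 * pi * x = of_int m * 2 * pi" unfolding cos_one_2pi_int by blast
  then have "x = of_int m" by simp
  then show ?thesis by simp
qed

lemma sum_cis_geometric:
  fixes y :: int and m :: nat
  assumes m: "m \<ge> 1"
  shows "(\<Sum>a=0..<int m. cis (2 * pi * (of_int a * of_int y / m))) = (if int m dvd y then of_nat m else 0)"
proof -
  define z where "z = cis (2 * pi * (of_int y / m))"
  have "cis (2 * pi * (of_int a * of_int y / m)) = z ^ nat a" if "0 \<le> a" for a :: int
    using that unfolding z_def Complex.DeMoivre by (simp add: mult.left_commute)
  then have "(\<Sum>a=0..<int m. cis (2 * pi * (of_int a * of_int y / m))) = (\<Sum>a=0..<int m. z ^ nat a)"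
    by (intro sum.cong) auto
  also have "\<dots> = (\<Sum>a<m. z ^ a)"
    by (rule sum.reindex_bij_witness[of _ int nat]) auto
  finally have "(\<Sum>a=0..<int m. cis (2 * pi * (of_int a * of_int y / m))) = (\<Sum>a<m. z ^ a)" .
  moreover have "z ^ m = 1"
    unfolding z_def Complex.DeMoivre using m cis_multiple_2pi[of "of_int y"] by simp
  moreover have "z = 1 \<longleftrightarrow> int m dvd y"
  proof
    assume "z = 1"
    then have "of_int y / real m \<in> \<int>" unfolding z_def by (rule cis_eq_1_imp)
    then obtain d :: int where "of_int y / real m = of_int d" by (auto elim: Ints_cases)
    then have "(of_int y :: real) = of_int (int m * d)" using m by (simp add: field_simps)
    then show "int m dvd y" by (metis dvd_triv_left of_int_eq_iff)
  next
    assume "int m dvd y"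
    then obtain d where "y = int m * d" ..
    then show "z = 1" using m cis_multiple_2pi[of "of_int d"] by (simp add: z_def)
  qed
  ultimately show ?thesis using geometric_sum[of z m] by auto
qed

text \<open>The coordinates \<open>a = (k\<^sub>1 - k\<^sub>4)/4\<close>, \<open>b = (k\<^sub>2 - k\<^sub>4)/4\<close>, \<open>c = - k\<^sub>4\<close> identify \<open>HH\<close> with triples of integers.
  In them congruence mod \<open>4n\<close> decouples (mod \<open>n\<close>, \<open>n\<close>, \<open>4n\<close>), so that \<open>Box n\<close> is a fundamental domain,
  and character sums over it factor into complete geometric sums.\<close>

definition lat :: "int \<times> int \<times> int \<Rightarrow> int^4" where
  "lat = (\<lambda>(a, b, c). \<chi> i. if i = 1 then 4 * a - c else if i = 2 then 4 * b - c
     else if i = 3 then 3 * c - 4 * a - 4 * b else - c)"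

lemma lat_nth [simp]:
  "lat (a, b, c) $ 1 = 4 * a - c" "lat (a, b, c) $ 2 = 4 * b - c"
  "lat (a, b, c) $ 3 = 3 * c - 4 * a - 4 * b" "lat (a, b, c) $ 4 = - c"
  by (simp_all add: lat_def)

lemma inj_lat: "inj lat"
  by (auto simp: inj_def vec_eq_iff forall_4)

definition Box :: "nat \<Rightarrow> (int^4) set" where
  "Box n = lat ` ({0..<int n} \<times> {0..<int n} \<times> {0..<int (4 * n)})"

lemma finite_Box: "finite (Box n)"
  by (simp add: Box_def)

lemma Box_subset_HH: "Box n \<subseteq> HH"
proof -
  have "lat (a, b, c) $ i mod 4 = - c mod 4" for a b c i
  proof -
    have "[4 * a - c = - c] (mod 4)" "[4 * b - c = - c] (mod 4)" "[3 * c - 4 * a - 4 * b = - c] (mod 4)"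
      unfolding cong_iff_dvd_diff by presburger+
    then show ?thesis using exhaust_4[of i] by (auto simp: cong_def)
  qed
  then show ?thesis by (auto simp: Box_def HH_def sum_4)
qed

lemma Box_unique:
  assumes n: "n \<ge> 1" and h: "h \<in> HH"
  shows "\<exists>!k. k \<in> Box n \<and> (\<forall>i. [k $ i = h $ i] (mod (4 * int n)))"
proof -
  have s: "h$1 + h$2 + h$3 + h$4 = 0" and m: "h$i mod 4 = h$4 mod 4" for i
    using h by (auto simp: HH_def sum_4)
  have "4 dvd h$1 - h$4" "4 dvd h$2 - h$4" using m[of 1] m[of 2] unfolding mod_eq_dvd_iff .
  then obtain a b where ab: "h$1 = 4 * a + h$4" "h$2 = 4 * b + h$4"
    by (metis dvdE diff_add_cancel)
  have hl: "h = lat (a, b, - h$4)"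
    using s ab by (simp add: vec_eq_iff forall_4)
  have c: "(\<forall>i. [lat (a', b', c') $ i = h $ i] (mod (4 * int n))) \<longleftrightarrow>
      [a' = a] (mod int n) \<and> [b' = b] (mod int n) \<and> [c' = - h$4] (mod (4 * int n))" (is "?l \<longleftrightarrow> ?r") for a' b' c'
  proof -
    have *: "[4 * x = 4 * y] (mod (4 * int n)) \<longleftrightarrow> [x = y] (mod int n)" for x y
      using dvd_mult_cancel_left[of 4 "int n" "x - y"] by (simp add: cong_iff_dvd_diff)
    show ?thesis
    proof
      assume l: ?l
      then have "[- (lat (a', b', c') $ 4) = - h$4] (mod (4 * int n))" by (simp only: cong_minus_minus_iff)
      then have c: "[c' = - h$4] (mod (4 * int n))" by simp
      have "[lat (a', b', c') $ i + c' = h$i + - h$4] (mod (4 * int n))" for i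
        using l c by (intro cong_add) auto
      from this[of 1] this[of 2] have "[4 * a' = 4 * a] (mod (4 * int n))" "[4 * b' = 4 * b] (mod (4 * int n))"
        using ab by simp_all
      then show ?r using c * by auto
    next
      assume ?r
      then have r: "[4 * a' = 4 * a] (mod (4 * int n))" "[4 * b' = 4 * b] (mod (4 * int n))" "[c' = - h$4] (mod (4 * int n))"
        using * by auto
      have "[lat (a', b', c') $ i = lat (a, b, - h$4) $ i] (mod (4 * int n))" for i
        using exhaust_4[of i] cong_diff[OF r(1) r(3)] cong_diff[OF r(2) r(3)]
          cong_diff[OF cong_diff[OF cong_scalar_left[OF r(3), of 3] r(1)] r(2)] cong_diff[OF cong_refl[of 0] r(3)]
        by auto
      then show ?l using hl by simp
    qed
  qed
  have ex1: "\<exists>!x. 0 \<le> x \<and> x < N \<and> [x = y] (mod N)" if "N > 0" for N y :: int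
  proof (rule ex1I[of _ "y mod N"])
    show "0 \<le> y mod N \<and> y mod N < N \<and> [y mod N = y] (mod N)" using that by simp
    show "x = y mod N" if "0 \<le> x \<and> x < N \<and> [x = y] (mod N)" for x
      using that mod_pos_pos_trivial[of x N] by (simp add: cong_def)
  qed
  obtain a' b' c' where e: "0 \<le> a' \<and> a' < int n \<and> [a' = a] (mod int n)" "0 \<le> b' \<and> b' < int n \<and> [b' = b] (mod int n)"
      "0 \<le> c' \<and> c' < 4 * int n \<and> [c' = - h$4] (mod (4 * int n))"
    using ex1[of "int n"] ex1[of "4 * int n"] n by (metis of_nat_0_less_iff zero_less_mult_iff zero_less_numeral less_eq_Suc_le One_nat_def)
  show ?thesis
  proof (rule ex1I[of _ "lat (a', b', c')"])
    show "lat (a', b', c') \<in> Box n \<and> (\<forall>i. [lat (a', b', c') $ i = h $ i] (mod (4 * int n)))"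
      unfolding c using e by (auto simp: Box_def)
  next
    fix k assume k: "k \<in> Box n \<and> (\<forall>i. [k $ i = h $ i] (mod (4 * int n)))"
    then obtain x y z where k': "k = lat (x, y, z)" "0 \<le> x" "x < int n" "0 \<le> y" "y < int n" "0 \<le> z" "z < 4 * int n"
      by (auto simp: Box_def)
    have "[x = a] (mod int n) \<and> [y = b] (mod int n) \<and> [z = - h$4] (mod (4 * int n))"
      using k unfolding k'(1) c by blast
    then have "x = a'" "y = b'" "z = c'"
      using ex1[of "int n" a] ex1[of "int n" b] ex1[of "4 * int n" "- h$4"] e k' n by auto
    then show "k = lat (a', b', c')" using k'(1) by simp
  qed
qed

text \<open>Nondegeneracy of the pairing: all three geometric sums survive only if \<open>d\<close>
  vanishes modulo \<open>4n\<close>.\<close>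

lemma sum_Box_chr:
  assumes n: "n \<ge> 1" and s: "(\<Sum>i\<in>UNIV. d $ i) = 0" and m: "\<And>i j. [d $ i = d $ j] (mod 4)"
  shows "(\<Sum>k\<in>Box n. chr n k d) = (if \<forall>i. 4 * int n dvd d $ i then 4 * of_nat n ^ 3 else 0)"
proof -
  obtain y1 y2 where y: "d$1 - d$3 = 4 * y1" "d$2 - d$3 = 4 * y2"
    using m by (metis cong_iff_dvd_diff dvdE)
  have s4: "d$1 + d$2 + d$3 + d$4 = 0" using s by (simp add: sum_4)
  \<comment> \<open>The zero sum of \<open>d\<close> eliminates \<open>d$4\<close>, and divisibility
    of the entry differences by 4 turns the denominator \<open>16n\<close> into \<open>n\<close>,
    \<open>n\<close> and \<open>4n\<close>.\<close>
  have dot: "dot4 (lat (a, b, c)) d = 4 * (4 * a * y1 + 4 * b * y2 + c * d$3)" for a b c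
  proof -
    have "dot4 (lat (a, b, c)) d = 4 * (a * (d$1 - d$3) + b * (d$2 - d$3) + c * d$3) - c * (d$1 + d$2 + d$3 + d$4)"
      by (simp add: dot4_def sum_4 algebra_simps)
    then show ?thesis unfolding s4 y by simp
  qed
  have e: "chr n (lat (a, b, c)) d = cis (2 * pi * (of_int a * of_int y1 / n)) *
      (cis (2 * pi * (of_int b * of_int y2 / n)) * cis (2 * pi * (of_int c * of_int (d$3) / real (4 * n))))" for a b c
    unfolding chr_def dot cis_mult using n by (intro arg_cong[where f = cis]) (simp add: field_simps)
  have "(\<Sum>k\<in>Box n. chr n k d) =
      (\<Sum>a=0..<int n. cis (2 * pi * (of_int a * of_int y1 / n))) *
      ((\<Sum>b=0..<int n. cis (2 * pi * (of_int b * of_int y2 / n))) *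
       (\<Sum>c=0..<int (4 * n). cis (2 * pi * (of_int c * of_int (d$3) / real (4 * n)))))"
    unfolding Box_def sum_product sum.cartesian_product
    by (subst sum.reindex) (auto simp: inj_on_subset[OF inj_lat] sum_product e sum.cartesian_product intro!: sum.cong)
  also have "\<dots> = (if int n dvd y1 then of_nat n else 0) * ((if int n dvd y2 then of_nat n else 0) *
      (if int (4 * n) dvd d$3 then of_nat (4 * n) else 0))"
    using n by (subst sum_cis_geometric, simp)+ simp
  also have "\<dots> = (if int n dvd y1 \<and> int n dvd y2 \<and> 4 * int n dvd d$3 then 4 * of_nat n ^ 3 else 0)"
    by (simp add: power3_eq_cube)
  also have "int n dvd y1 \<and> int n dvd y2 \<and> 4 * int n dvd d$3 \<longleftrightarrow> (\<forall>i. 4 * int n dvd d $ i)" (is "?l \<longleftrightarrow> ?r")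
  proof -
    have "int n dvd y1 \<longleftrightarrow> 4 * int n dvd d$1 - d$3" "int n dvd y2 \<longleftrightarrow> 4 * int n dvd d$2 - d$3"
      unfolding y by simp_all
    moreover have "d$4 = - (d$1 - d$3) - (d$2 - d$3) - 3 * d$3" using s4 by simp
    moreover have "d$1 = (d$1 - d$3) + d$3" "d$2 = (d$2 - d$3) + d$3" by simp_all
    ultimately show ?thesis unfolding forall_4
      by (metis dvd_add dvd_diff dvd_minus_iff dvd_mult)
  qed
  finally show ?thesis .
qed

section \<open>Folding sums onto the alcove\<close>

lemma pvec_HH: "k \<in> HH \<Longrightarrow> \<sigma> permutes UNIV \<Longrightarrow> pvec k \<sigma> \<in> HH"
  using sum.permute[of \<sigma> UNIV "\<lambda>i. k $ i"] by (simp add: HH_def o_def)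

lemma refl4_HH: "k \<in> HH \<Longrightarrow> refl4 (4 * N) k \<in> HH"
proof -
  assume k: "k \<in> HH"
  have "refl4 (4 * N) k $ i mod 4 = k $ 1 mod 4" for i
    using k exhaust_4[of i] by (auto simp: refl4_def HH_def mod_simps cong: mod_mult_cong intro: mod_eq_dvd_iff[THEN iffD2])
  then show ?thesis using k by (auto simp: HH_def sum_4 refl4_def)
qed

lemma cong4_pvec: "cong4 m \<sigma> k l \<Longrightarrow> cong4 m (\<sigma> \<circ> \<tau>) k (pvec l \<tau>)"
  by (simp add: cong4_def)

lemma cong4_pvec_iff:
  assumes "\<tau> permutes UNIV"
  shows "cong4 m (\<sigma> \<circ> \<tau>) k (pvec l \<tau>) \<longleftrightarrow> cong4 m \<sigma> k l"
  unfolding cong4_def pvec_nth o_def using permutes_inverses(1)[OF assms] by metis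

lemma cong4_0: "cong4 0 \<sigma> k l \<longleftrightarrow> pvec k \<sigma> = l"
  by (simp add: cong4_def vec_eq_iff)

lemma Lambda_iff: "k \<in> Lambda n \<longleftrightarrow> k \<in> HH \<and> sorted4 k \<and> k$1 \<le> k$4 + 4 * int n"
  by (auto simp: Lambda_def sorted4_def)

lemma finite_Hstar: "finite (Hstar n)"
proof -
  \<comment> \<open>By the zero sum, \<open>4 * k$i\<close> is the sum of the differences
    \<open>k$i - k$j\<close> over the three other indices, hence at most \<open>12n\<close> in
    absolute value.\<close>
  let ?I = "{- 12 * int n..12 * int n}"
  let ?v = "\<lambda>(a, b, c, d). (\<chi> i. if i = 1 then a else if i = 2 then b else if i = 3 then c else d) :: int^4"
  have "k \<in> ?v ` (?I \<times> ?I \<times> ?I \<times> ?I)" if k: "k \<in> Hstar n" for k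
  proof (rule image_eqI)
    show "k = ?v (k$1, k$2, k$3, k$4)" by (simp add: vec_eq_iff forall_4)
    have s: "k$1 + k$2 + k$3 + k$4 = 0" using k by (simp add: Hstar_def HH_def sum_4)
    have "\<forall>i j. - 4 * int n \<le> k$i - k$j \<and> k$i - k$j \<le> 4 * int n" using k by (simp add: Hstar_def)
    then have "- 4 * int n \<le> k$i - k$j" "k$i - k$j \<le> 4 * int n" for i j by blast+
    from this[of 1 2] this[of 1 3] this[of 1 4] this[of 2 3] this[of 2 4] this[of 3 4] s
    show "(k$1, k$2, k$3, k$4) \<in> ?I \<times> ?I \<times> ?I \<times> ?I" by auto
  qed
  then have "Hstar n \<subseteq> ?v ` (?I \<times> ?I \<times> ?I \<times> ?I)" by blast
  then show ?thesis by (rule finite_subset) simp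
qed

lemma Lambda_subset_Hstar: "Lambda n \<subseteq> Hstar n"
proof
  fix k assume k: "k \<in> Lambda n"
  have "- 4 * int n \<le> k$i - k$j \<and> k$i - k$j \<le> 4 * int n" for i j
    using k exhaust_4[of i] exhaust_4[of j] by (auto simp: Lambda_def)
  then show "k \<in> Hstar n" using k by (simp add: Hstar_def Lambda_def)
qed

lemma finite_Lambda: "finite (Lambda n)"
  using Lambda_subset_Hstar finite_Hstar by (rule finite_subset)

lemma pvec_Hstar: "k \<in> Hstar n \<Longrightarrow> \<sigma> permutes UNIV \<Longrightarrow> pvec k \<sigma> \<in> Hstar n"
  by (auto simp: Hstar_def pvec_HH)

lemma card_S4: "card {\<sigma>. \<sigma> permutes (UNIV :: 4 set)} = 24"
  using card_permutations[of "UNIV :: 4 set" 4] by (simp add: fact_numeral)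

lemma pvec_pvec: "pvec (pvec k \<sigma>) \<tau> = pvec k (\<sigma> \<circ> \<tau>)"
  by (simp add: pvec_def)

lemma pvec_inverses:
  assumes "\<sigma> permutes UNIV"
  shows "pvec (pvec k (inv \<sigma>)) \<sigma> = k" "pvec (pvec k \<sigma>) (inv \<sigma>) = k"
  by (simp_all add: vec_eq_iff permutes_inverses[OF assms])

lemma Lambda_unique_cong4:
  assumes n: "n \<ge> 1" and l: "l \<in> Lambda n" "l' \<in> Lambda n"
    and s: "\<sigma> permutes UNIV" "\<sigma>' permutes UNIV" and R: "cong4 (4 * int n) \<sigma> a l" "cong4 (4 * int n) \<sigma>' a l'"
  shows "l = l'"
proof -
  have "\<sigma> \<circ> (inv \<sigma> \<circ> \<sigma>') = \<sigma>'"
    using permutes_inv_o[OF s(1)] by (simp add: o_assoc)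
  then have "cong4 (4 * int n) (inv \<sigma> \<circ> \<sigma>') l l'"
    using cong4_comp[OF R(1), of "inv \<sigma> \<circ> \<sigma>'" l'] R(2) by simp
  moreover have "inv \<sigma> \<circ> \<sigma>' permutes UNIV"
    using s by (intro permutes_compose permutes_inv)
  ultimately show ?thesis
    using Lambda_unique[OF n l, of "inv \<sigma> \<circ> \<sigma>'"] by (simp add: cong4_def)
qed

lemma sum_Box_Lambda:
  fixes F :: "int^4 \<Rightarrow> complex"
  assumes n: "n \<ge> 1"
    and F: "\<And>k l \<sigma>. k \<in> HH \<Longrightarrow> l \<in> HH \<Longrightarrow> \<sigma> permutes UNIV \<Longrightarrow> cong4 (4 * int n) \<sigma> k l \<Longrightarrow> F k = F l"
  shows "(\<Sum>k\<in>Box n. F k) = (\<Sum>l\<in>Lambda n. of_real (lam n l) * F l)"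
proof (rule sum_transversal[where P = "{\<sigma>. \<sigma> permutes UNIV}" and R = "cong4 (4 * int n)"])
  show "finite {\<sigma>. \<sigma> permutes (UNIV :: 4 set)}" by (simp add: finite_permutations)
  show "{\<sigma>. \<sigma> permutes (UNIV :: 4 set)} \<noteq> {}" using permutes_id by blast
  show "finite (Box n)" "finite (Lambda n)" by (fact finite_Box finite_Lambda)+
next
  fix a assume a: "a \<in> Box n"
  then have aH: "a \<in> HH" using Box_subset_HH by blast
  \<comment> \<open>The full orbit of \<open>a\<close> under the affine Weyl group: as both sums of
    entries are 0, the shift lies in \<open>4n\<close> times the lattice A_3.\<close>
  define X where "X = {k \<in> HH. \<exists>\<sigma>. \<sigma> permutes UNIV \<and> cong4 (4 * int n) \<sigma> a k}"
  have "a \<in> X" using aH permutes_id by (auto simp: X_def cong4_def intro!: exI[of _ id])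
  moreover have "pvec k (Transposition.transpose i j) \<in> X" if "k \<in> X" for k i j
  proof -
    obtain \<sigma> where s: "\<sigma> permutes UNIV" "cong4 (4 * int n) \<sigma> a k" and k: "k \<in> HH" using \<open>k \<in> X\<close> by (auto simp: X_def)
    have t: "Transposition.transpose i j permutes UNIV" by (rule permutes_swap_id) auto
    show ?thesis
      unfolding X_def using pvec_HH[OF k t] permutes_compose[OF t s(1)] cong4_pvec[OF s(2)] by blast
  qed
  ultimately obtain k where k: "k \<in> X" "sorted4 k" "refl4 (4 * int n) k \<in> X \<longrightarrow> k$1 \<le> k$4 + 4 * int n"
    using exists_dominant[OF n, of X] by blast
  obtain \<sigma> where s: "\<sigma> permutes UNIV" "cong4 (4 * int n) \<sigma> a k" and kH: "k \<in> HH" using k(1) by (auto simp: X_def)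
  have t: "Transposition.transpose (1::4) 4 permutes UNIV" by (rule permutes_swap_id) auto
  \<comment> \<open>The affine reflection is a transposition followed by a shift by multiples of
    \<open>4n\<close>, so it preserves \<open>X\<close>.\<close>
  have "[pvec k (Transposition.transpose 1 4) $ i = refl4 (4 * int n) k $ i] (mod (4 * int n))" for i
    by (auto simp: refl4_def Transposition.transpose_def cong_iff_dvd_diff)
  then have "cong4 (4 * int n) (\<sigma> \<circ> Transposition.transpose 1 4) a (refl4 (4 * int n) k)"
    using cong4_pvec[OF s(2), of "Transposition.transpose 1 4"] unfolding cong4_def by (meson cong_trans)
  then have "refl4 (4 * int n) k \<in> X"
    unfolding X_def using refl4_HH[OF kH] permutes_compose[OF t s(1)] by blast
  then have "k \<in> Lambda n" using k kH by (simp add: Lambda_iff)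
  then show "\<exists>l\<in>Lambda n. \<exists>\<sigma>\<in>{\<sigma>. \<sigma> permutes UNIV}. cong4 (4 * int n) \<sigma> a l" using s by blast
next
  fix a l l' \<sigma> \<sigma>'
  assume "l \<in> Lambda n" "l' \<in> Lambda n" "\<sigma> \<in> {\<sigma>. \<sigma> permutes UNIV}" "\<sigma>' \<in> {\<sigma>. \<sigma> permutes UNIV}"
    "cong4 (4 * int n) \<sigma> a l" "cong4 (4 * int n) \<sigma>' a l'"
  then show "l = l'" using Lambda_unique_cong4[OF n] by blast
next
  fix a l \<sigma>
  assume l: "l \<in> Lambda n" and s: "\<sigma> \<in> {\<sigma>. \<sigma> permutes UNIV}" "cong4 (4 * int n) \<sigma> a l"
  show "lam n l * card {\<sigma> \<in> {\<sigma>. \<sigma> permutes UNIV}. cong4 (4 * int n) \<sigma> a l} = card {\<sigma>. \<sigma> permutes (UNIV :: 4 set)}"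
    using lam_card_stabilizer_mod[OF n l] card_cong4[of \<sigma> "4 * int n" a l l] s by (simp add: card_S4 cong4_def)
next
  fix l \<sigma>
  assume l: "l \<in> Lambda n" and "\<sigma> \<in> {\<sigma>. \<sigma> permutes (UNIV :: 4 set)}"
  then have s: "\<sigma> permutes UNIV" by simp
  have "pvec l (inv \<sigma>) \<in> HH" using l pvec_HH[OF _ permutes_inv[OF s]] by (simp add: Lambda_iff)
  from Box_unique[OF n this]
  have "\<exists>!a. a \<in> Box n \<and> cong4 (4 * int n) (inv \<sigma>) l a" by (simp add: cong4_def cong_sym_eq)
  then show "\<exists>!a. a \<in> Box n \<and> cong4 (4 * int n) \<sigma> a l" using cong4_swap[OF s] by simp
next
  fix a l \<sigma>
  assume "a \<in> Box n" "l \<in> Lambda n" "\<sigma> \<in> {\<sigma>. \<sigma> permutes UNIV}" "cong4 (4 * int n) \<sigma> a l"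
  then show "F a = F l" using F[of a l \<sigma>] Box_subset_HH by (auto simp: Lambda_iff)
qed

lemma range_pvec: "\<sigma> permutes UNIV \<Longrightarrow> range (\<lambda>i. pvec k \<sigma> $ i) = range (\<lambda>i. k $ i)"
  using permutes_image[of \<sigma> UNIV] by (simp add: image_image[symmetric, of "\<lambda>i. k $ i" \<sigma>])

lemma cst_pvec:
  assumes s: "\<sigma> permutes UNIV"
  shows "cst n (pvec k \<sigma>) = cst n k"
proof -
  have "card {i. pvec k \<sigma> $ i = x} = card {i. k $ i = x}" for x
    using card_vimage_inj[of \<sigma> "{i. k $ i = x}"] permutes_inj[OF s] permutes_surj[OF s] by (simp add: vimage_def)
  then show ?thesis unfolding cst_def range_pvec[OF s] Let_def by simp
qed

text \<open>The orbit of \<open>l\<close> in \<open>Hstar n\<close> has \<open>24 / st l\<close>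
  points, all of weight \<open>cst n l\<close>; their total weight is \<open>lam n l\<close> by
  \<open>lam_card_stabilizer\<close>.\<close>

lemma sum_Hstar_Lambda:
  fixes F :: "int^4 \<Rightarrow> complex"
  assumes n: "n \<ge> 1"
    and F: "\<And>k \<sigma>. \<sigma> permutes UNIV \<Longrightarrow> F (pvec k \<sigma>) = F k"
  shows "(\<Sum>k\<in>Hstar n. of_real (cst n k) * F k) = (\<Sum>l\<in>Lambda n. of_real (lam n l) * F l)"
proof -
  define st where "st l = card {\<sigma>. \<sigma> permutes UNIV \<and> cong4 0 \<sigma> l l}" for l
  have st: "st l \<noteq> 0" for l
  proof -
    have "\<exists>\<sigma>. \<sigma> permutes UNIV \<and> cong4 0 \<sigma> l l"
      by (intro exI[of _ id]) (simp add: cong4_def permutes_id)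
    then show ?thesis unfolding st_def by (subst card_0_eq) (auto simp: finite_permutations)
  qed
  have "(\<Sum>k\<in>Hstar n. of_real (cst n k) * F k) = (\<Sum>l\<in>Lambda n. of_real (24 / st l) * (of_real (cst n l) * F l))"
  proof (rule sum_transversal[where P = "{\<sigma>. \<sigma> permutes UNIV}" and R = "cong4 0"])
    show "finite {\<sigma>. \<sigma> permutes (UNIV :: 4 set)}" by (simp add: finite_permutations)
    show "{\<sigma>. \<sigma> permutes (UNIV :: 4 set)} \<noteq> {}" using permutes_id by blast
    show "finite (Hstar n)" "finite (Lambda n)" by (fact finite_Hstar finite_Lambda)+
  next
    fix a assume a: "a \<in> Hstar n"
    define X where "X = {pvec a \<sigma> | \<sigma>. \<sigma> permutes UNIV}"
    have "pvec k (Transposition.transpose i j) \<in> X" if "k \<in> X" for k i j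
    proof -
      obtain \<sigma> where s: "\<sigma> permutes UNIV" "k = pvec a \<sigma>" using \<open>k \<in> X\<close> by (auto simp: X_def)
      have t: "Transposition.transpose i j permutes UNIV" by (rule permutes_swap_id) auto
      show ?thesis unfolding X_def s(2) pvec_pvec using permutes_compose[OF t s(1)] by blast
    qed
    moreover have "X \<noteq> {}" unfolding X_def using permutes_id by blast
    ultimately obtain k where k: "k \<in> X" "sorted4 k" using exists_dominant[OF n, of X] by blast
    then obtain \<sigma> where s: "\<sigma> permutes UNIV" "k = pvec a \<sigma>" by (auto simp: X_def)
    have "k \<in> Hstar n" using pvec_Hstar[OF a s(1)] s(2) by simp
    then have "k \<in> HH" "k$1 - k$4 \<le> 4 * int n" by (auto simp: Hstar_def)
    then have "k \<in> Lambda n" using k by (simp add: Lambda_iff)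
    then show "\<exists>l\<in>Lambda n. \<exists>\<sigma>\<in>{\<sigma>. \<sigma> permutes UNIV}. cong4 0 \<sigma> a l" using s by (auto simp: cong4_0)
  next
    fix a l l' \<sigma> \<sigma>'
    assume "l \<in> Lambda n" "l' \<in> Lambda n" "\<sigma> \<in> {\<sigma>. \<sigma> permutes UNIV}" "\<sigma>' \<in> {\<sigma>. \<sigma> permutes UNIV}"
      "cong4 0 \<sigma> a l" "cong4 0 \<sigma>' a l'"
    then show "l = l'" using Lambda_unique_cong4[OF n, of l l' \<sigma> \<sigma>' a] by (simp add: cong4_def)
  next
    fix a l \<sigma>
    assume l: "l \<in> Lambda n" and s: "\<sigma> \<in> {\<sigma>. \<sigma> permutes UNIV}" "cong4 0 \<sigma> a l"
    show "24 / st l * card {\<sigma> \<in> {\<sigma>. \<sigma> permutes UNIV}. cong4 0 \<sigma> a l} = card {\<sigma>. \<sigma> permutes (UNIV :: 4 set)}"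
      using card_cong4[of \<sigma> 0 a l l] s st by (simp add: card_S4 st_def)
  next
    fix l \<sigma>
    assume l: "l \<in> Lambda n" and "\<sigma> \<in> {\<sigma>. \<sigma> permutes (UNIV :: 4 set)}"
    then have s: "\<sigma> permutes UNIV" by simp
    have "l \<in> Hstar n" using l Lambda_subset_Hstar by blast
    then show "\<exists>!a. a \<in> Hstar n \<and> cong4 0 \<sigma> a l"
      unfolding cong4_0 using pvec_Hstar[OF _ permutes_inv[OF s]] pvec_inverses[OF s] by metis
  next
    fix a l \<sigma>
    assume "\<sigma> \<in> {\<sigma>. \<sigma> permutes UNIV}" "cong4 0 \<sigma> a l"
    then show "of_real (cst n a) * F a = of_real (cst n l) * F l"
      using F[of \<sigma> a] cst_pvec[of \<sigma> n a] by (simp add: cong4_0)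
  qed
  also have "\<dots> = (\<Sum>l\<in>Lambda n. of_real (lam n l) * F l)"
  proof (rule sum.cong)
    fix l assume "l \<in> Lambda n"
    then have "lam n l * st l = 24 * cst n l" using lam_card_stabilizer[OF n] by (simp add: st_def cong4_def)
    then have "lam n l = 24 / st l * cst n l" using st[of l] by (simp add: field_simps)
    then show "of_real (24 / st l) * (of_real (cst n l) * F l) = of_real (lam n l) * F l" by simp
  qed simp
  finally show ?thesis .
qed

section \<open>Discrete orthogonality and interpolation\<close>

lemma chr_commute: "chr n k j = chr n j k"
  by (simp add: chr_def dot4_commute)

lemma chr_diff: "chr n k (i - j) = chr n k i * cnj (chr n k j)"
  by (simp add: chr_def dot4_def cis_cnj cis_mult right_diff_distrib sum_subtractf diff_divide_distrib)

text \<open>The congruence condition in \<open>HH\<close> makes the pairing descend to the quotient.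
  If \<open>k - k'\<close> is \<open>4n\<close> times \<open>a\<close>, then \<open>a\<close> has
  sum 0, so subtracting \<open>j$1\<close> from every entry of \<open>j\<close> leaves the product
  of \<open>a\<close> and \<open>j\<close> unchanged and shows that it is divisible by 4. Thus the
  exponent changes by a multiple of \<open>16n\<close>.\<close>

lemma chr_cong:
  assumes n: "n \<ge> 1" and H: "k \<in> HH" "k' \<in> HH" "j \<in> HH"
    and c: "\<And>i. [k $ i = k' $ i] (mod (4 * int n))"
  shows "chr n k j = chr n k' j"
proof -
  have "\<forall>i. \<exists>a. k $ i = k' $ i + 4 * int n * a"
    using c by (metis cong_iff_lin cong_sym)
  then obtain a where a: "\<And>i. k $ i = k' $ i + 4 * int n * a i" by metis
  have "(\<Sum>i\<in>UNIV. k $ i) = (\<Sum>i\<in>UNIV. k' $ i) + 4 * int n * (\<Sum>i\<in>UNIV. a i)"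
    by (simp add: a sum.distrib sum_distrib_left)
  then have a0: "(\<Sum>i\<in>UNIV. a i) = 0" using H n by (simp add: HH_def)
  have "4 dvd j $ i - j $ 1" for i using H(3) by (simp add: HH_def mod_eq_dvd_iff)
  then have "4 dvd (\<Sum>i\<in>UNIV. a i * (j $ i - j $ 1))" by (intro dvd_sum dvd_mult)
  also have "(\<Sum>i\<in>UNIV. a i * (j $ i - j $ 1)) = (\<Sum>i\<in>UNIV. a i * j $ i) - (\<Sum>i\<in>UNIV. a i) * j $ 1"
    by (simp add: right_diff_distrib sum_subtractf sum_distrib_right)
  finally obtain m where m: "(\<Sum>i\<in>UNIV. a i * j $ i) = 4 * m" using a0 by auto
  have "dot4 k j = dot4 k' j + 4 * int n * (\<Sum>i\<in>UNIV. a i * j $ i)"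
    by (simp add: dot4_def a distrib_right sum.distrib sum_distrib_left mult.assoc)
  then have "dot4 k j = dot4 k' j + 16 * int n * m" by (simp add: m)
  then have "2 * pi * of_int (dot4 k j) / (16 * real n) = 2 * pi * of_int (dot4 k' j) / (16 * real n) + 2 * pi * of_int m"
    using n by (simp add: field_simps)
  then show ?thesis unfolding chr_def using cis_multiple_2pi[of "of_int m"] by (simp flip: cis_mult)
qed

lemma permact_node: "permact (node n j) \<sigma> = node n (pvec j \<sigma>)"
  by (simp add: permact_def node_def vec_eq_iff)

lemma TC_node: "TC k (node n j) = (1/24) * (\<Sum>\<sigma> | \<sigma> permutes UNIV. chr n k (pvec j \<sigma>))"
  by (simp add: TC_def Pplus_def permact_node phi_node)

lemma chr_pvec: "\<sigma> permutes UNIV \<Longrightarrow> chr n k (pvec j \<sigma>) = chr n (pvec k (inv \<sigma>)) j"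
  by (simp add: chr_def dot4_pvec)

lemma TC_node_pvec: "TC k (node n j) = (1/24) * (\<Sum>\<sigma> | \<sigma> permutes UNIV. chr n (pvec k \<sigma>) j)"
proof -
  have "(\<Sum>\<sigma> | \<sigma> permutes UNIV. chr n k (pvec j \<sigma>)) = (\<Sum>\<sigma> | \<sigma> permutes UNIV. chr n (pvec k (inv \<sigma>)) j)"
    by (intro sum.cong) (simp_all add: chr_pvec)
  also have "\<dots> = (\<Sum>\<sigma> | \<sigma> permutes UNIV. chr n (pvec k \<sigma>) j)"
    by (rule sum_permutations_inverse[symmetric])
  finally show ?thesis by (simp only: TC_node)
qed

text \<open>Averaging over the node and averaging over the index give the same result, so the
  symmetry of \<open>chr\<close> survives.\<close>

lemma TC_node_commute: "TC k (node n j) = TC j (node n k)"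
  unfolding TC_node_pvec[of k] TC_node[of j] by (simp add: chr_commute)

lemma phi_pvec:
  assumes "\<sigma> permutes UNIV"
  shows "phi (pvec k \<sigma>) t = phi k (permact t (inv \<sigma>))"
  using sum.permute[OF assms, of "\<lambda>i. of_int (k $ i) * t $ inv \<sigma> i"]
  by (simp add: phi_def permact_def o_def permutes_inverses[OF assms])

lemma permact_permact: "permact (permact t \<sigma>) \<tau> = permact t (\<sigma> \<circ> \<tau>)"
  by (simp add: permact_def)

lemma TC_pvec:
  assumes "\<tau> permutes UNIV"
  shows "TC (pvec k \<tau>) t = TC k t"
  using sum_permutations_compose_right[OF permutes_inv[OF assms], of "\<lambda>\<sigma>. phi k (permact t \<sigma>)"]
  by (simp add: TC_def Pplus_def phi_pvec[OF assms] permact_permact)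

lemma TC_node_cong:
  assumes n: "n \<ge> 1" and H: "k \<in> HH" "l \<in> HH" "j \<in> HH" and s: "\<sigma> permutes UNIV" "cong4 (4 * int n) \<sigma> k l"
  shows "TC k (node n j) = TC l (node n j)"
proof -
  have "chr n (pvec k \<sigma>) (pvec j \<tau>) = chr n l (pvec j \<tau>)" if "\<tau> permutes UNIV" for \<tau>
    using s(2) by (intro chr_cong[OF n] pvec_HH H s that) (simp add: cong4_def)
  then have "TC (pvec k \<sigma>) (node n j) = TC l (node n j)"
    unfolding TC_node by simp
  then show ?thesis by (simp add: TC_pvec[OF s(1)])
qed

text \<open>The product of two averages is a double sum of characters at
  \<open>pvec i \<sigma> - pvec j \<tau>\<close>, and summation over the box keeps the pairs with
  \<open>pvec i \<sigma>\<close> congruent to \<open>pvec j \<tau>\<close>. Right translation makes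
  their number independent of \<open>\<tau>\<close>, which leaves 24/576 = 1/24.\<close>

lemma orthogonality_Box:
  assumes n: "n \<ge> 1" and i: "i \<in> HH" and j: "j \<in> HH"
  shows "(\<Sum>k\<in>Box n. TC k (node n i) * cnj (TC k (node n j))) =
    4 * of_nat n ^ 3 / 24 * of_nat (card {\<sigma>. \<sigma> permutes UNIV \<and> cong4 (4 * int n) \<sigma> i j})"
proof -
  let ?P = "{\<sigma>. \<sigma> permutes (UNIV :: 4 set)}"
  have fin: "finite ?P" by (simp add: finite_permutations)
  have "TC k (node n i) * cnj (TC k (node n j)) =
      (1/576) * (\<Sum>\<tau>\<in>?P. \<Sum>\<sigma>\<in>?P. chr n k (pvec i \<sigma> - pvec j \<tau>))" for k
    unfolding TC_node chr_diff by (subst sum.swap) (simp add: sum_product)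
  then have "(\<Sum>k\<in>Box n. TC k (node n i) * cnj (TC k (node n j))) =
      (1/576) * (\<Sum>k\<in>Box n. \<Sum>\<tau>\<in>?P. \<Sum>\<sigma>\<in>?P. chr n k (pvec i \<sigma> - pvec j \<tau>))"
    by (simp only: sum_distrib_left)
  also have "(\<Sum>k\<in>Box n. \<Sum>\<tau>\<in>?P. \<Sum>\<sigma>\<in>?P. chr n k (pvec i \<sigma> - pvec j \<tau>)) =
      (\<Sum>\<tau>\<in>?P. \<Sum>\<sigma>\<in>?P. \<Sum>k\<in>Box n. chr n k (pvec i \<sigma> - pvec j \<tau>))"
    by (subst sum.swap, rule sum.cong[OF refl], rule sum.swap)
  also have "(\<Sum>\<tau>\<in>?P. \<Sum>\<sigma>\<in>?P. \<Sum>k\<in>Box n. chr n k (pvec i \<sigma> - pvec j \<tau>)) =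
      (\<Sum>\<tau>\<in>?P. \<Sum>\<sigma>\<in>?P. 4 * of_nat n ^ 3 * of_bool (cong4 (4 * int n) \<sigma> i (pvec j \<tau>)))"
  proof (intro sum.cong refl)
    fix \<tau> \<sigma> assume "\<tau> \<in> ?P" "\<sigma> \<in> ?P"
    then have H: "pvec i \<sigma> \<in> HH" "pvec j \<tau> \<in> HH" using pvec_HH i j by auto
    have "(\<Sum>x\<in>UNIV. (pvec i \<sigma> - pvec j \<tau>) $ x) = 0"
      using H by (simp add: HH_def sum_subtractf del: pvec_nth)
    moreover have "[(pvec i \<sigma> - pvec j \<tau>) $ x = (pvec i \<sigma> - pvec j \<tau>) $ y] (mod 4)" for x y
      using H unfolding vector_minus_component by (intro cong_diff) (auto simp: HH_def cong_def simp del: pvec_nth)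
    ultimately show "(\<Sum>k\<in>Box n. chr n k (pvec i \<sigma> - pvec j \<tau>)) =
        4 * of_nat n ^ 3 * of_bool (cong4 (4 * int n) \<sigma> i (pvec j \<tau>))"
      by (simp add: sum_Box_chr[OF n] cong4_def cong_iff_dvd_diff)
  qed
  also have "\<dots> = (\<Sum>\<tau>\<in>?P. 4 * of_nat n ^ 3 * of_nat (card {\<sigma>. \<sigma> permutes UNIV \<and> cong4 (4 * int n) \<sigma> i j}))"
  proof (rule sum.cong)
    fix \<tau> assume "\<tau> \<in> ?P"
    then have t: "\<tau> permutes UNIV" by simp
    have "(\<Sum>\<sigma>\<in>?P. of_bool (cong4 (4 * int n) \<sigma> i (pvec j \<tau>)) :: complex) =
        (\<Sum>\<sigma>\<in>?P. of_bool (cong4 (4 * int n) \<sigma> i j))"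
      by (subst sum_permutations_compose_right[OF t]) (simp only: cong4_pvec_iff[OF t])
    also have "\<dots> = of_nat (card {\<sigma>. \<sigma> permutes UNIV \<and> cong4 (4 * int n) \<sigma> i j})"
      using fin by (simp add: Int_def)
    finally show "(\<Sum>\<sigma>\<in>?P. 4 * of_nat n ^ 3 * of_bool (cong4 (4 * int n) \<sigma> i (pvec j \<tau>))) =
        4 * of_nat n ^ 3 * (of_nat (card {\<sigma>. \<sigma> permutes UNIV \<and> cong4 (4 * int n) \<sigma> i j}) :: complex)"
      by (simp only: sum_distrib_left[symmetric])
  qed simp
  finally show ?thesis by (simp add: card_S4)
qed

lemma orthogonality_Lambda:
  assumes n: "n \<ge> 1" and i: "i \<in> Lambda n" and j: "j \<in> Lambda n"
  shows "of_real (lam n j) / (4 * of_nat n ^ 3) *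
      (\<Sum>k\<in>Lambda n. of_real (lam n k) * (TC k (node n i) * cnj (TC k (node n j)))) = of_bool (i = j)"
proof -
  have H: "i \<in> HH" "j \<in> HH" using i j by (simp_all add: Lambda_iff)
  let ?c = "card {\<sigma>. \<sigma> permutes UNIV \<and> cong4 (4 * int n) \<sigma> i j}"
  have A: "(\<Sum>k\<in>Lambda n. of_real (lam n k) * (TC k (node n i) * cnj (TC k (node n j)))) =
      4 * of_nat n ^ 3 / 24 * of_nat ?c"
    unfolding orthogonality_Box[OF n H, symmetric]
    by (rule sum_Box_Lambda[OF n, symmetric]) (metis TC_node_cong[OF n] H)
  have "of_real (lam n j) / (4 * of_nat n ^ 3) *
      (\<Sum>k\<in>Lambda n. of_real (lam n k) * (TC k (node n i) * cnj (TC k (node n j)))) = of_real (lam n j) * of_nat ?c / 24"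
    unfolding A using n by simp
  moreover have "lam n j * ?c = 24 * of_bool (i = j)"
  proof (cases "i = j")
    case True
    then show ?thesis using lam_card_stabilizer_mod[OF n j] by (simp add: cong4_def)
  next
    case False
    then have "\<not> cong4 (4 * int n) \<sigma> i j" if "\<sigma> permutes UNIV" for \<sigma>
      using Lambda_unique[OF n i j that] by (auto simp: cong4_def)
    then have "{\<sigma>. \<sigma> permutes UNIV \<and> cong4 (4 * int n) \<sigma> i j} = {}" by blast
    then show ?thesis using False by simp
  qed
  then have "complex_of_real (lam n j * ?c) = of_real (24 * of_bool (i = j))" by (simp only:)
  then have "complex_of_real (lam n j) * of_nat ?c = 24 * of_bool (i = j)" by simp
  ultimately show ?thesis by simp
qed

lemma ell_tri_node:
  assumes "n \<ge> 1" "i \<in> Lambda n" "j \<in> Lambda n"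
  shows "ell_tri n j (node n i) = of_bool (i = j)"
  using orthogonality_Lambda[OF assms] by (simp add: ell_tri_def mult.assoc)

text \<open>Symmetry exchanges node and index, so the sum over the nodes \<open>j\<close> becomes
  the same orthogonality relation, now between the nodes of \<open>m\<close> and
  \<open>k\<close>.\<close>

lemma interpolation_reproduces_TC:
  assumes n: "n \<ge> 1" and m: "m \<in> Lambda n"
  shows "(\<Sum>j\<in>Lambda n. TC m (node n j) * ell_tri n j t) = TC m t"
proof -
  have "(\<Sum>j\<in>Lambda n. TC m (node n j) * ell_tri n j t) =
      (\<Sum>j\<in>Lambda n. \<Sum>k\<in>Lambda n. TC k t * (of_real (lam n k) / (4 * of_nat n ^ 3) *
        (of_real (lam n j) * (TC j (node n m) * cnj (TC j (node n k))))))"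
    unfolding ell_tri_def sum_distrib_left
  proof (intro sum.cong refl)
    fix j k
    show "TC m (node n j) * (of_real (lam n j) / (4 * of_nat n ^ 3) * (of_real (lam n k) * TC k t * cnj (TC k (node n j)))) =
        TC k t * (of_real (lam n k) / (4 * of_nat n ^ 3) * (of_real (lam n j) * (TC j (node n m) * cnj (TC j (node n k)))))"
      unfolding TC_node_commute[of m n j] TC_node_commute[of k n j] by simp
  qed
  also have "\<dots> = (\<Sum>k\<in>Lambda n. TC k t * of_bool (m = k))"
    by (subst sum.swap, rule sum.cong[OF refl]) (simp only: sum_distrib_left[symmetric] orthogonality_Lambda[OF n m])
  also have "\<dots> = TC m t"
    using m finite_Lambda[of n] by (simp add: if_distrib[of "\<lambda>x. _ * x"] of_bool_def cong: if_cong)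
  finally show ?thesis .
qed

lemma ell_tri_eq_Pplus:
  assumes n: "n \<ge> 1"
  shows "ell_tri n j t = of_real (lam n j) * Pplus (ell n j) t"
proof -
  let ?P = "{\<sigma>. \<sigma> permutes (UNIV :: 4 set)}"
  have d: "phi k (s - u) = phi k s * cnj (phi k u)" for k s u
    by (simp add: phi_def exp_cnj right_diff_distrib sum_subtractf diff_divide_distrib flip: exp_add)
  define S where "S = (\<Sum>k\<in>Hstar n. of_real (cst n k) * (TC k t * cnj (phi k (node n j))))"
  have "Pplus (ell n j) t = (1 / (4 * of_nat n ^ 3)) * ((1/24) * (\<Sum>\<sigma>\<in>?P. \<Sum>k\<in>Hstar n.
      of_real (cst n k) * (phi k (permact t \<sigma>) * cnj (phi k (node n j)))))"
    unfolding Pplus_def ell_def Phistar_def d by (simp add: sum_divide_distrib)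
  also have "(1/24) * (\<Sum>\<sigma>\<in>?P. \<Sum>k\<in>Hstar n. of_real (cst n k) * (phi k (permact t \<sigma>) * cnj (phi k (node n j)))) = S"
    unfolding S_def TC_def Pplus_def
    by (subst sum.swap) (simp add: sum_distrib_left sum_distrib_right mult_ac)
  finally have 1: "Pplus (ell n j) t = (1 / (4 * of_nat n ^ 3)) * S" .
  \<comment> \<open>\<open>Pplus\<close> averages only the factor at \<open>t\<close>. Replacing
    \<open>k\<close> by \<open>pvec k \<tau>\<close> preserves \<open>Hstar n\<close>,
    \<open>cst\<close> and \<open>TC\<close>, so it puts a permutation on the other factor alone;
    averaging over \<open>\<tau>\<close> then produces \<open>TC\<close> at the node as
    well.\<close>
  have S_pvec: "S = (\<Sum>k\<in>Hstar n. of_real (cst n k) * (TC k t * cnj (phi (pvec k \<tau>) (node n j))))" if t: "\<tau> \<in> ?P" for \<tau>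
  proof -
    have p: "\<tau> permutes UNIV" using t by simp
    show ?thesis unfolding S_def
      by (rule sum.reindex_bij_witness[of _ "\<lambda>k. pvec k \<tau>" "\<lambda>k. pvec k (inv \<tau>)"])
        (use p permutes_inv[OF p] in \<open>simp_all add: pvec_inverses pvec_Hstar cst_pvec TC_pvec\<close>)
  qed
  have "24 * S = (\<Sum>\<tau>\<in>?P. S)" by (simp add: card_S4)
  also have "\<dots> = (\<Sum>\<tau>\<in>?P. \<Sum>k\<in>Hstar n. of_real (cst n k) * (TC k t * cnj (phi (pvec k \<tau>) (node n j))))"
    by (intro sum.cong refl S_pvec)
  also have "\<dots> = (\<Sum>k\<in>Hstar n. of_real (cst n k) * (TC k t * cnj (\<Sum>\<tau>\<in>?P. phi (pvec k \<tau>) (node n j))))"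
    by (subst sum.swap) (simp add: sum_distrib_left)
  also have "\<dots> = 24 * (\<Sum>k\<in>Hstar n. of_real (cst n k) * (TC k t * cnj (TC k (node n j))))"
    by (simp add: TC_node_pvec phi_node sum_distrib_left)
  also have "(\<Sum>k\<in>Hstar n. of_real (cst n k) * (TC k t * cnj (TC k (node n j)))) =
      (\<Sum>k\<in>Lambda n. of_real (lam n k) * (TC k t * cnj (TC k (node n j))))"
    by (rule sum_Hstar_Lambda[OF n]) (simp add: TC_pvec)
  finally show ?thesis unfolding 1 ell_tri_def by (simp add: mult.assoc)
qed

theorem theorem4p7:
  fixes n :: nat and f :: "real^4 \<Rightarrow> complex"
  assumes "n \<ge> 1" and "continuous_on triangleH f"
  shows "Lstar n f \<in> TCspace n
       \<and> (\<forall>j\<in>Lambda n. Lstar n f (node n j) = f (node n j))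
       \<and> (\<forall>g\<in>TCspace n. (\<forall>j\<in>Lambda n. g (node n j) = f (node n j)) \<longrightarrow>
            (\<forall>t\<in>RH. g t = Lstar n f t))
       \<and> (\<forall>j\<in>Lambda n. \<forall>t\<in>RH. ell_tri n j t = of_real (lam n j) * Pplus (ell n j) t)"
proof (intro conjI ballI impI)
  define c where "c k = (\<Sum>j\<in>Lambda n. f (node n j) * (of_real (lam n j) / (4 * of_nat n ^ 3) *
      (of_real (lam n k) * cnj (TC k (node n j)))))" for k
  have "Lstar n f t = (\<Sum>k\<in>Lambda n. c k * TC k t)" for t
  proof -
    have "Lstar n f t = (\<Sum>j\<in>Lambda n. \<Sum>k\<in>Lambda n. f (node n j) * (of_real (lam n j) / (4 * of_nat n ^ 3) *
      (of_real (lam n k) * cnj (TC k (node n j)))) * TC k t)"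
      unfolding Lstar_def ell_tri_def sum_distrib_left by (intro sum.cong refl) (simp add: mult_ac)
    then show ?thesis
      unfolding c_def sum_distrib_right by (subst sum.swap)
  qed
  then show "Lstar n f \<in> TCspace n" by (auto simp: TCspace_def)
next
  fix i assume i: "i \<in> Lambda n"
  have "Lstar n f (node n i) = (\<Sum>j\<in>Lambda n. if i = j then f (node n j) else 0)"
    unfolding Lstar_def using ell_tri_node[OF assms(1) i] by (intro sum.cong) auto
  then show "Lstar n f (node n i) = f (node n i)"
    using i finite_Lambda by simp
next
  fix g t assume "g \<in> TCspace n" and g: "\<forall>j\<in>Lambda n. g (node n j) = f (node n j)"
  then obtain c where c: "g = (\<lambda>t. \<Sum>k\<in>Lambda n. c k * TC k t)" by (auto simp: TCspace_def)
  \<comment> \<open>Only the values of \<open>f\<close> at the nodes enter, and there they are those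
    of \<open>g\<close>; so this is the interpolation operator applied to \<open>g\<close>.\<close>
  have "Lstar n f t = (\<Sum>j\<in>Lambda n. \<Sum>k\<in>Lambda n. c k * (TC k (node n j) * ell_tri n j t))"
    unfolding Lstar_def
  proof (intro sum.cong refl)
    fix j assume "j \<in> Lambda n"
    then have "f (node n j) = (\<Sum>k\<in>Lambda n. c k * TC k (node n j))" using g by (simp add: c)
    then show "f (node n j) * ell_tri n j t = (\<Sum>k\<in>Lambda n. c k * (TC k (node n j) * ell_tri n j t))"
      by (simp only: sum_distrib_right mult.assoc)
  qed
  also have "\<dots> = (\<Sum>k\<in>Lambda n. c k * TC k t)"
    by (subst sum.swap) (simp add: interpolation_reproduces_TC[OF assms(1)] sum_distrib_left[symmetric])
  finally show "g t = Lstar n f t" by (simp add: c)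
next
  fix j t
  show "ell_tri n j t = of_real (lam n j) * Pplus (ell n j) t" by (rule ell_tri_eq_Pplus[OF assms(1)])
qed

end
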